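(* Let $E$ be a real linear space, $\psi:E\to\mathbb{R}$ a seminorm, $K, A\subseteq E$ nontrivial cones with normlike-bases $B_K$ and $B_A$ (with respect to $\psi$), and let $K$ be solid. Define $S_{-K}:=\mathrm{conv}(-B_K)$ and $S_A^0:=\mathrm{conv}(B_A\cup\{0\})$. If $S_{-K}$ is solid and $S_A^0\cap\mathrm{cor}\,S_{-K}=\emptyset$, then there exists $(x',\alpha)\in K^{a\circ}$ such that $$x'(a)+\alpha\psi(a)\ \geq\ 0\ \geq\ x'(k)+\alpha\psi(k)\quad\text{for all } a\in A\text{ and }k\in -K,$$ $$x'(a)+\alpha\psi(a)\ \geq\ 0\ >\ x'(k)+\alpha\psi(k)\quad\text{for all } a\in A\text{ and }k\in \mathrm{cor}(-K).$$ In particular, $A\cap\mathrm{cor}(-K)=\emptyset$ and $0\notin\mathrm{cor}\,S_{-K}$.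
   Context: $E\neq\{0\}$ is a real linear space with algebraic dual $E'$; $\mathbb{R}_+=[0,\infty)$. A set $K\subseteq E$ is a cone if $0\in K=\mathbb{R}_+\cdot K$ (not necessarily convex); it is nontrivial if $\{0\}\neq K\neq E$; $\ell(K):=K\cap(-K)$ (same notation for cones in $E'$). A seminorm is a sublinear symmetric function $\psi:E\to\mathbb{R}$. A nontrivial cone $K$ has a normlike-base (w.r.t. $\psi$) if $\psi(x)>0$ for all $x\in K\setminus\{0\}$; the normlike-base is then $B_K:=\{x\in K\mid \psi(x)=1\}$. All normlike-bases are taken with respect to the same fixed seminorm $\psi$. For $\Omega\subseteq E$: $\mathrm{cor}\,\Omega:=\{x\in\Omega\mid \forall v\in E\ \exists\varepsilon>0:\ x+[0,\varepsilon]\cdot v\subseteq\Omega\}$ and $\mathrm{icor}\,\Omega:=\{x\in\Omega\mid \forall v\in \mathrm{aff}(\Omega-\Omega)\ \exists\varepsilon>0:\ x+[0,\varepsilon]\cdot v\subseteq\Omega\}$, where $\mathrm{aff}$ is the affine hull; $\Omega$ is solid if $\mathrm{cor}\,\Omega\neq\emptyset$. $\mathrm{conv}$ denotes the convex hull. $K^+:=\{y'\in E'\mid \forall k\in K:\ y'(k)\geq 0\}$ and $K^{a\circ}:=\{(x',\alpha)\in (K^+\setminus\ell(K^+))\times\mathbb{R}_+\mid \forall y\in\mathrm{icor}\,K:\ x'(y)-\alpha\psi(y)>0\}$. *)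

theory Defs
  imports "HOL-Analysis.Convex"
begin

text \<open>The linear space is a type of class \<open>real_vector\<close>; no topology and no
  dimension restriction is assumed. Since \<open>- S\<close> denotes the complement of a set \<open>S\<close>
  in HOL, the reflection of a set is written \<open>uminus ` S\<close>.\<close>

definition cone0 :: "'a::real_vector set \<Rightarrow> bool" where
  "cone0 K \<longleftrightarrow> 0 \<in> K \<and> K = {t *\<^sub>R x | t x. t \<ge> 0 \<and> x \<in> K}"

lemma cone0_iff_cone: "cone0 K \<longleftrightarrow> 0 \<in> K \<and> cone K"
proof
  assume "cone0 K"
  then show "0 \<in> K \<and> cone K"
    unfolding cone0_def cone_def by blast
next
  assume K: "0 \<in> K \<and> cone K"
  have "x \<in> {t *\<^sub>R x | t x. t \<ge> 0 \<and> x \<in> K}" if "x \<in> K" for x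
    using that by (auto intro!: exI[of _ "1::real"] exI[of _ x])
  then show "cone0 K"
    using K unfolding cone0_def cone_def by blast
qed

definition nontrivial_cone :: "'a::real_vector set \<Rightarrow> bool" where
  "nontrivial_cone K \<longleftrightarrow> cone0 K \<and> K \<noteq> {0} \<and> K \<noteq> UNIV"

text \<open>Polymorphic, because it is applied both to cones of vectors and to cones of
  functionals; on functions \<open>uminus\<close> is pointwise.\<close>

definition lineality :: "'v::uminus set \<Rightarrow> 'v set" where
  "lineality K = K \<inter> uminus ` K"

definition sublinear :: "('a::real_vector \<Rightarrow> real) \<Rightarrow> bool" where
  "sublinear \<psi> \<longleftrightarrow>
     (\<forall>x y. \<psi> (x + y) \<le> \<psi> x + \<psi> y) \<and> (\<forall>t x. t \<ge> 0 \<longrightarrow> \<psi> (t *\<^sub>R x) = t * \<psi> x)"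

definition seminorm :: "('a::real_vector \<Rightarrow> real) \<Rightarrow> bool" where
  "seminorm \<psi> \<longleftrightarrow> sublinear \<psi> \<and> (\<forall>x. \<psi> (- x) = \<psi> x)"

definition has_normlike_base :: "('a::real_vector \<Rightarrow> real) \<Rightarrow> 'a set \<Rightarrow> bool" where
  "has_normlike_base \<psi> K \<longleftrightarrow> (\<forall>x \<in> K - {0}. \<psi> x > 0)"

definition normlike_base :: "('a::real_vector \<Rightarrow> real) \<Rightarrow> 'a set \<Rightarrow> 'a set" where
  "normlike_base \<psi> K = {x \<in> K. \<psi> x = 1}"

definition cor :: "'a::real_vector set \<Rightarrow> 'a set" where
  "cor \<Omega> = {x \<in> \<Omega>. \<forall>v. \<exists>\<epsilon>>0. \<forall>t \<in> {0..\<epsilon>}. x + t *\<^sub>R v \<in> \<Omega>}"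

definition icor :: "'a::real_vector set \<Rightarrow> 'a set" where
  "icor \<Omega> = {x \<in> \<Omega>. \<forall>v \<in> affine hull {y - z | y z. y \<in> \<Omega> \<and> z \<in> \<Omega>}.
                      \<exists>\<epsilon>>0. \<forall>t \<in> {0..\<epsilon>}. x + t *\<^sub>R v \<in> \<Omega>}"

definition solid :: "'a::real_vector set \<Rightarrow> bool" where
  "solid \<Omega> \<longleftrightarrow> cor \<Omega> \<noteq> {}"

definition algebraic_dual :: "('a::real_vector \<Rightarrow> real) set" where
  "algebraic_dual = {y'. linear y'}"

definition dual_cone :: "'a::real_vector set \<Rightarrow> ('a \<Rightarrow> real) set" where
  "dual_cone K = {y' \<in> algebraic_dual. \<forall>k \<in> K. y' k \<ge> 0}"

text \<open>The augmented dual cone \<open>K\<^sup>a\<^sup>\<circ>\<close>, with respect to \<open>\<psi>\<close>.\<close>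

definition aug_dual_icor ::
    "('a::real_vector \<Rightarrow> real) \<Rightarrow> 'a set \<Rightarrow> (('a \<Rightarrow> real) \<times> real) set" where
  "aug_dual_icor \<psi> K =
     {(x', \<alpha>) \<in> (dual_cone K - lineality (dual_cone K)) \<times> {0..}.
        \<forall>y \<in> icor K. x' y - \<alpha> * \<psi> y > 0}"

text \<open>\<open>S\<^bsub>-K\<^esub>\<close> is \<open>S_neg \<psi> K\<close>, and \<open>S\<^sub>A\<^sup>0\<close> is \<open>S_zero \<psi> A\<close>.\<close>

definition S_neg :: "('a::real_vector \<Rightarrow> real) \<Rightarrow> 'a set \<Rightarrow> 'a set" where
  "S_neg \<psi> K = convex hull (uminus ` normlike_base \<psi> K)"

definition S_zero :: "('a::real_vector \<Rightarrow> real) \<Rightarrow> 'a set \<Rightarrow> 'a set" where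
  "S_zero \<psi> A = convex hull (normlike_base \<psi> A \<union> {0})"

end

theory Submission
  imports Defs
begin

text \<open>A linear functional \<open>x'\<close> and a level \<open>-\<alpha>\<close> separating \<open>S\<^sub>A\<^sup>0\<close> from \<open>S\<^bsub>-K\<^esub>\<close> give the pair
  \<open>(x', \<alpha>)\<close>: since \<open>0 \<in> S\<^sub>A\<^sup>0\<close> we get \<open>\<alpha> \<ge> 0\<close>, and homogeneity turns the bounds on the bases into
  sign conditions for the sublinear function \<open>x' + \<alpha>\<psi>\<close> on the cones. This function is negative
  somewhere on \<open>-B\<^sub>K\<close>, because the separation is proper, and hence, being sublinear and
  nonpositive on \<open>-K\<close>, negative on \<open>cor (-K)\<close>. The algebraic separation theorem is
  obtained from the fact that a minimal sublinear functional is linear.\<close>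

section \<open>Sublinear functions and seminorms\<close>

lemma sublinear_zero: "sublinear p \<Longrightarrow> p 0 = 0"
  unfolding sublinear_def by (metis mult_zero_left order_refl scaleR_zero_left)

lemma sublinear_add: "sublinear p \<Longrightarrow> p (x + y) \<le> p x + p y"
  by (simp add: sublinear_def)

lemma sublinear_scale: "sublinear p \<Longrightarrow> t \<ge> 0 \<Longrightarrow> p (t *\<^sub>R x) = t * p x"
  by (simp add: sublinear_def)

lemma sublinear_ge_neg: "sublinear p \<Longrightarrow> - p (- x) \<le> p x"
  using sublinear_add[of p x "- x"] sublinear_zero[of p] by simp

lemma seminorm_nonneg: "seminorm \<psi> \<Longrightarrow> \<psi> x \<ge> 0"
  using sublinear_ge_neg[of \<psi> x] by (simp add: seminorm_def)

text \<open>A common source of sublinear functions: \<open>W x\<close> collects candidate values at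
  \<open>x\<close>. Adding a value at \<open>x\<close> to a value \<open>r\<close> at
  \<open>- x\<close> lands above a value in \<open>W 0\<close>, so \<open>- r\<close> bounds
  \<open>W x\<close> from below and \<open>Inf\<close> is a genuine infimum.\<close>

lemma sublinear_Inf:
  fixes W :: "'a::real_vector \<Rightarrow> real set"
  assumes ne: "\<And>x. W x \<noteq> {}"
    and add: "\<And>x y s r. s \<in> W x \<Longrightarrow> r \<in> W y \<Longrightarrow> \<exists>u \<in> W (x + y). u \<le> s + r"
    and scale: "\<And>x s t. t > 0 \<Longrightarrow> s \<in> W x \<Longrightarrow> t * s \<in> W (t *\<^sub>R x)"
    and zero: "0 \<in> W 0" and nonneg: "\<And>s. s \<in> W 0 \<Longrightarrow> s \<ge> 0"
  shows "sublinear (\<lambda>x. Inf (W x)) \<and> (\<forall>x. \<forall>s \<in> W x. Inf (W x) \<le> s)"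
proof -
  have "bdd_below (W x)" for x
  proof -
    obtain r where r: "r \<in> W (- x)" using ne by blast
    have "- r \<le> s" if s: "s \<in> W x" for s
    proof -
      obtain u where "u \<in> W (x + - x)" "u \<le> s + r" using add[OF s r] by blast
      then show ?thesis using nonneg[of u] by simp
    qed
    then show ?thesis by (meson bdd_belowI)
  qed
  then have lower: "Inf (W x) \<le> s" if "s \<in> W x" for x s
    using that by (simp add: cInf_lower)
  have sub: "Inf (W (x + y)) \<le> Inf (W x) + Inf (W y)" for x y
  proof -
    have "Inf (W (x + y)) \<le> s + r" if "s \<in> W x" "r \<in> W y" for s r
      using add[OF that] lower[of _ "x + y"] by force
    then have "Inf (W (x + y)) - s \<le> Inf (W y)" if "s \<in> W x" for s
      using that ne by (intro cInf_greatest) (auto simp: diff_le_eq add.commute[of _ s])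
    then have "Inf (W (x + y)) - Inf (W y) \<le> Inf (W x)"
      using ne by (intro cInf_greatest) (auto simp: algebra_simps)
    then show ?thesis by simp
  qed
  have scale_le: "Inf (W (t *\<^sub>R x)) \<le> t * Inf (W x)" if t: "t > 0" for t x
  proof -
    have "Inf (W (t *\<^sub>R x)) / t \<le> Inf (W x)"
    proof (rule cInf_greatest[OF ne])
      fix s assume "s \<in> W x"
      then have "Inf (W (t *\<^sub>R x)) \<le> t * s" using lower[OF scale[OF t]] by blast
      then show "Inf (W (t *\<^sub>R x)) / t \<le> s" using t by (simp add: field_simps)
    qed
    then show ?thesis using t by (simp add: field_simps)
  qed
  \<comment> \<open>The reverse inequality is \<open>scale_le\<close> for the factor
    \<open>inverse t\<close> at \<open>t *\<^sub>R x\<close>.\<close>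
  have scale_eq: "Inf (W (t *\<^sub>R x)) = t * Inf (W x)" if t: "t > 0" for t x
    using scale_le[OF t, of x] scale_le[of "inverse t" "t *\<^sub>R x"] t by (simp add: field_simps)
  have "Inf (W 0) = 0"
    using lower[OF zero] cInf_greatest[OF ne nonneg] by force
  with sub scale_eq have "sublinear (\<lambda>x. Inf (W x))"
    unfolding sublinear_def by (metis less_eq_real_def mult_zero_left scaleR_zero_left)
  with lower show ?thesis by blast
qed

section \<open>Linear minorants from minimal sublinear functions\<close>

lemma chain_sublinear_lower_bound:
  assumes "C \<noteq> {}" and C: "\<And>q. q \<in> C \<Longrightarrow> sublinear q"
    and chain: "\<And>q r. q \<in> C \<Longrightarrow> r \<in> C \<Longrightarrow> q \<le> r \<or> r \<le> q"
  shows "\<exists>m. sublinear m \<and> (\<forall>q \<in> C. m \<le> q)"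
proof -
  define W where "W x = (\<lambda>q. q x) ` C" for x
  have "sublinear (\<lambda>x. Inf (W x)) \<and> (\<forall>x. \<forall>s \<in> W x. Inf (W x) \<le> s)"
  proof (rule sublinear_Inf)
    fix x y s r assume "s \<in> W x" "r \<in> W y"
    then obtain q q' where q: "q \<in> C" "s = q x" "q' \<in> C" "r = q' y"
      by (auto simp: W_def)
    \<comment> \<open>The smaller of the two chain members serves both points at once.\<close>
    obtain u where u: "u \<in> C" "u \<le> q" "u \<le> q'"
      using chain[OF q(1,3)] q by blast
    have "u (x + y) \<le> u x + u y" using C[OF u(1)] by (rule sublinear_add)
    also have "\<dots> \<le> s + r" using u q by (simp add: le_fun_def add_mono)
    finally show "\<exists>u \<in> W (x + y). u \<le> s + r" using u by (auto simp: W_def)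
  next
    fix x s and t :: real assume t: "t > 0" and "s \<in> W x"
    then obtain q where q: "q \<in> C" "s = q x" by (auto simp: W_def)
    then have "t * s = q (t *\<^sub>R x)" using t sublinear_scale[OF C] by simp
    then show "t * s \<in> W (t *\<^sub>R x)" using q by (simp add: W_def)
  qed (use assms sublinear_zero in \<open>force simp: W_def\<close>)+
  then show ?thesis by (intro exI[of _ "\<lambda>x. Inf (W x)"]) (auto simp: W_def le_fun_def)
qed

text \<open>Fix a direction \<open>x\<close>. The infimum over \<open>t \<ge> 0\<close> of
  \<open>p (y + t *\<^sub>R x) - t * p x\<close> is sublinear in \<open>y\<close>, and
  \<open>t = 0\<close> puts it below \<open>p\<close>. Minimality makes it equal to
  \<open>p\<close>, and then \<open>t = 1\<close> yields superadditivity.\<close>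

lemma minimal_sublinear_linear:
  assumes p: "sublinear p" and min: "\<And>q. sublinear q \<Longrightarrow> q \<le> p \<Longrightarrow> q = p"
  shows "linear p"
proof -
  have ge: "p y + p x \<le> p (y + x)" for x y
  proof -
    define W where "W y = {p (y + t *\<^sub>R x) - t * p x | t. t \<ge> 0}" for y
    have W: "sublinear (\<lambda>x. Inf (W x)) \<and> (\<forall>x. \<forall>s \<in> W x. Inf (W x) \<le> s)"
    proof (rule sublinear_Inf)
      fix a b s r assume "s \<in> W a" "r \<in> W b"
      then obtain t t' where t: "t \<ge> 0" "s = p (a + t *\<^sub>R x) - t * p x"
        "t' \<ge> 0" "r = p (b + t' *\<^sub>R x) - t' * p x"
        by (auto simp: W_def)
      have "p (a + b + (t + t') *\<^sub>R x) - (t + t') * p x \<le> s + r"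
        using sublinear_add[OF p, of "a + t *\<^sub>R x" "b + t' *\<^sub>R x"] t by (simp add: algebra_simps)
      moreover have "p (a + b + (t + t') *\<^sub>R x) - (t + t') * p x \<in> W (a + b)"
        using t unfolding W_def by (smt (verit) mem_Collect_eq)
      ultimately show "\<exists>u \<in> W (a + b). u \<le> s + r" by blast
    next
      fix a s and c :: real assume c: "c > 0" and "s \<in> W a"
      then obtain t where t: "t \<ge> 0" "s = p (a + t *\<^sub>R x) - t * p x"
        by (auto simp: W_def)
      have "c * s = p (c *\<^sub>R a + (c * t) *\<^sub>R x) - (c * t) * p x"
        using sublinear_scale[OF p, of c "a + t *\<^sub>R x"] c t
        by (simp add: scaleR_add_right right_diff_distrib mult.assoc)
      then show "c * s \<in> W (c *\<^sub>R a)"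
        using c t unfolding W_def by (metis (mono_tags, lifting) mem_Collect_eq mult_nonneg_nonneg less_imp_le)
    qed (use sublinear_zero[OF p] sublinear_scale[OF p] in \<open>auto simp: W_def intro: exI[of _ "0::real"]\<close>)
    have "p y \<in> W y" for y
      unfolding W_def by (auto intro: exI[of _ "0::real"])
    then have "(\<lambda>x. Inf (W x)) \<le> p" using W by (simp add: le_fun_def)
    then have "(\<lambda>x. Inf (W x)) = p" using W min by blast
    then have "p y \<le> s" if "s \<in> W y" for s using W that by metis
    moreover have "p (y + x) - p x \<in> W y"
      unfolding W_def by (auto intro: exI[of _ "1::real"])
    ultimately show ?thesis by force
  qed
  have add: "p (x + y) = p x + p y" for x y
    using ge[of x y] sublinear_add[OF p, of x y] by simp
  have neg: "p (- x) = - p x" for x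
    using add[of x "- x"] sublinear_zero[OF p] by simp
  have "p (t *\<^sub>R x) = t * p x" for t x
    using sublinear_scale[OF p, of t x] sublinear_scale[OF p, of "- t" x] neg[of "t *\<^sub>R x"]
    by (cases "t \<ge> 0") auto
  with add show ?thesis by (simp add: linearI)
qed

text \<open>Zorn's lemma for the reversed order gives a minimal sublinear function below
  \<open>p\<close>, which is linear.\<close>

lemma sublinear_dominates_linear:
  fixes p :: "'a::real_vector \<Rightarrow> real"
  assumes p: "sublinear p"
  shows "\<exists>f. linear f \<and> f \<le> p"
proof -
  define S where "S = {q. sublinear q \<and> q \<le> p}"
  have "\<exists>m \<in> S. \<forall>q \<in> S. q \<le> m \<longrightarrow> q = m"
  proof (rule predicate_Zorn)
    show "partial_order_on S (relation_of (\<lambda>f g. g \<le> f) S)"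
      by (rule partial_order_on_relation_ofI) auto
    fix C assume "C \<in> Chains (relation_of (\<lambda>f g. g \<le> f) S)"
    then have C: "C \<subseteq> S" "\<And>q r. q \<in> C \<Longrightarrow> r \<in> C \<Longrightarrow> q \<le> r \<or> r \<le> q"
      by (auto simp: Chains_def relation_of_def)
    show "\<exists>u \<in> S. \<forall>q \<in> C. u \<le> q"
    proof (cases "C = {}")
      case True
      then show ?thesis using p by (auto simp: S_def)
    next
      case False
      then obtain m where "sublinear m" "\<forall>q \<in> C. m \<le> q"
        using chain_sublinear_lower_bound[of C] C by (auto simp: S_def)
      moreover have "m \<le> p" using calculation False C by (force simp: S_def)
      ultimately show ?thesis by (auto simp: S_def)
    qed
  qed
  then obtain m where m: "sublinear m" "m \<le> p" "\<And>q. q \<in> S \<Longrightarrow> q \<le> m \<Longrightarrow> q = m"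
    by (auto simp: S_def)
  \<comment> \<open>Minimality within \<open>S\<close> is minimality among all sublinear functions,
    since whatever lies below \<open>m\<close> also lies below \<open>p\<close>.\<close>
  have "q = m" if "sublinear q" "q \<le> m" for q
    using m that by (auto simp: S_def intro: order_trans)
  then show ?thesis using minimal_sublinear_linear m by blast
qed

section \<open>Algebraic interior and separation of convex sets\<close>

lemma cor_subset: "cor C \<subseteq> C"
  by (auto simp: cor_def)

lemma cor_D:
  assumes "x \<in> cor C" obtains t where "t > 0" "x + t *\<^sub>R v \<in> C"
proof -
  obtain e where "e > 0" "\<forall>t \<in> {0..e}. x + t *\<^sub>R v \<in> C"
    using assms by (auto simp: cor_def)
  then show ?thesis using that[of e] by auto
qed

text \<open>The room around \<open>y\<close>, shrunk by the factor \<open>1 - l\<close>, is room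
  around the combination: a step \<open>t\<close> there comes from a step \<open>t / (1 - l)\<close>
  at \<open>y\<close>.\<close>

lemma cor_convex_combination:
  assumes C: "convex C" and x: "x \<in> C" and y: "y \<in> cor C" and l: "0 \<le> l" "l < 1"
  shows "l *\<^sub>R x + (1 - l) *\<^sub>R y \<in> cor C"
proof -
  have "\<exists>e>0. \<forall>t \<in> {0..e}. l *\<^sub>R x + (1 - l) *\<^sub>R y + t *\<^sub>R v \<in> C" for v
  proof -
    obtain e where e: "e > 0" "\<forall>t \<in> {0..e}. y + t *\<^sub>R v \<in> C"
      using y by (auto simp: cor_def)
    have "l *\<^sub>R x + (1 - l) *\<^sub>R y + t *\<^sub>R v \<in> C" if "t \<in> {0..(1 - l) * e}" for t
    proof -
      have "y + (t / (1 - l)) *\<^sub>R v \<in> C" using that l e by (simp add: field_simps)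
      then have "l *\<^sub>R x + (1 - l) *\<^sub>R (y + (t / (1 - l)) *\<^sub>R v) \<in> C"
        using C x l by (simp add: convex_alt convexD)
      then show ?thesis using l by (simp add: scaleR_add_right add.assoc)
    qed
    then show ?thesis using e l by (intro exI[of _ "(1 - l) * e"]) auto
  qed
  moreover have "l *\<^sub>R x + (1 - l) *\<^sub>R y \<in> C"
    using C x y l cor_subset by (intro convexD) auto
  ultimately show ?thesis by (simp add: cor_def)
qed

text \<open>Take for \<open>z\<close> the weighted mean of \<open>x\<close> and \<open>y\<close>.
  The total weight \<open>s + r\<close> is preserved, which makes the values \<open>s - r\<close> in
  the separation proof add up.\<close>

lemma convex_cone_add:
  assumes C: "convex C" and "x \<in> C" "y \<in> C" and "s \<ge> 0" "r \<ge> 0"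
  shows "\<exists>z \<in> C. s *\<^sub>R (x - c) + r *\<^sub>R (y - c) = (s + r) *\<^sub>R (z - c)"
proof (cases "s + r = 0")
  case True
  then have "s = 0" "r = 0" using assms by auto
  then show ?thesis using assms by auto
next
  case False
  define z where "z = (s / (s + r)) *\<^sub>R x + (r / (s + r)) *\<^sub>R y"
  have "z \<in> C" unfolding z_def
    using assms False by (intro convexD) (auto simp: add_divide_distrib[symmetric])
  moreover have "(s + r) *\<^sub>R z = s *\<^sub>R x + r *\<^sub>R y"
    using False by (simp add: z_def scaleR_add_right)
  ultimately show ?thesis by (intro bexI[of _ z]) (auto simp: algebra_simps)
qed

text \<open>With \<open>c0\<close> moved to the origin, the infimum is a gauge of
  \<open>C - c0\<close> that also credits directions pointing away from \<open>D - c0\<close>.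
  Disjointness is what keeps it from being negative at 0. The level is \<open>f c0 + 1\<close>,
  hence strict at \<open>c0\<close>.\<close>

lemma separation_cor:
  fixes C D :: "'a::real_vector set"
  assumes C: "convex C" and D: "convex D" "D \<noteq> {}" and c0: "c0 \<in> cor C"
    and disj: "D \<inter> cor C = {}"
  shows "\<exists>(f :: 'a \<Rightarrow> real) \<gamma>. linear f \<and> (\<forall>d \<in> D. f d \<ge> \<gamma>) \<and> (\<forall>x \<in> C. f x \<le> \<gamma>) \<and> f c0 < \<gamma>"
proof -
  \<comment> \<open>A linear \<open>f\<close> lies below \<open>Inf \<circ> W\<close> exactly if \<open>f \<le> 1\<close> on \<open>C - c0\<close> and \<open>f \<ge> 1\<close> on \<open>D - c0\<close>.\<close>
  define W where "W x = {s - r | s r c d. s \<ge> 0 \<and> r \<ge> 0 \<and> c \<in> C \<and> d \<in> D \<and>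
    x = s *\<^sub>R (c - c0) - r *\<^sub>R (d - c0)}" for x
  have WI: "u \<in> W x" if "s \<ge> 0" "r \<ge> 0" "c \<in> C" "d \<in> D" "u = s - r"
    "x = s *\<^sub>R (c - c0) - r *\<^sub>R (d - c0)" for u x s r c d
    using that unfolding W_def by blast
  obtain d0 where d0: "d0 \<in> D" using D by blast
  have c0C: "c0 \<in> C" using c0 cor_subset by blast
  have W: "sublinear (\<lambda>x. Inf (W x)) \<and> (\<forall>x. \<forall>s \<in> W x. Inf (W x) \<le> s)"
  proof (rule sublinear_Inf)
    fix x
    \<comment> \<open>Since \<open>c0\<close> is algebraically interior, each \<open>x\<close> is a
      positive multiple of some \<open>c - c0\<close>, so the infimum runs over a nonempty
      set.\<close>
    obtain t where t: "t > 0" "c0 + t *\<^sub>R x \<in> C" using cor_D[OF c0] by blast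
    then have "inverse t - 0 \<in> W x" using d0 by (intro WI[of "inverse t" 0 _ d0]) auto
    then show "W x \<noteq> {}" by blast
  next
    fix x y u w assume "u \<in> W x" "w \<in> W y"
    then obtain s r c d s' r' c' d' where 1:
      "s \<ge> 0" "r \<ge> 0" "c \<in> C" "d \<in> D" "u = s - r" "x = s *\<^sub>R (c - c0) - r *\<^sub>R (d - c0)"
      "s' \<ge> 0" "r' \<ge> 0" "c' \<in> C" "d' \<in> D" "w = s' - r'" "y = s' *\<^sub>R (c' - c0) - r' *\<^sub>R (d' - c0)"
      unfolding W_def by blast
    obtain c'' where c'': "c'' \<in> C"
      "s *\<^sub>R (c - c0) + s' *\<^sub>R (c' - c0) = (s + s') *\<^sub>R (c'' - c0)"
      using convex_cone_add[OF C] 1 by blast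
    obtain d'' where d'': "d'' \<in> D"
      "r *\<^sub>R (d - c0) + r' *\<^sub>R (d' - c0) = (r + r') *\<^sub>R (d'' - c0)"
      using convex_cone_add[OF D(1)] 1 by blast
    have "x + y = (s *\<^sub>R (c - c0) + s' *\<^sub>R (c' - c0)) - (r *\<^sub>R (d - c0) + r' *\<^sub>R (d' - c0))"
      using 1 by simp
    then have "u + w \<in> W (x + y)"
      using 1 by (intro WI[OF _ _ c''(1) d''(1), of "s + s'" "r + r'"]) (auto simp: c'' d'')
    then show "\<exists>v \<in> W (x + y). v \<le> u + w" by blast
  next
    fix x u and t :: real assume "t > 0" "u \<in> W x"
    then obtain s r c d where 1: "s \<ge> 0" "r \<ge> 0" "c \<in> C" "d \<in> D" "u = s - r"
      "x = s *\<^sub>R (c - c0) - r *\<^sub>R (d - c0)"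
      unfolding W_def by blast
    with \<open>t > 0\<close> show "t * u \<in> W (t *\<^sub>R x)"
      by (intro WI[of "t * s" "t * r" c d]) (auto simp: right_diff_distrib scaleR_right_diff_distrib)
  next
    show "0 \<in> W 0" using c0C d0 by (intro WI[of 0 0 c0 d0]) auto
  next
    fix u assume "u \<in> W 0"
    then obtain s r c d where 1: "s \<ge> 0" "r \<ge> 0" "c \<in> C" "d \<in> D" "u = s - r"
      "s *\<^sub>R (c - c0) = r *\<^sub>R (d - c0)"
      unfolding W_def by auto
    show "u \<ge> 0"
    \<comment> \<open>A negative value means \<open>s < r\<close>; then \<open>d\<close> is a convex
      combination of \<open>c\<close> and \<open>c0\<close> with positive weight on
      \<open>c0\<close>, so it lies in \<open>cor C\<close>.\<close>
    proof (rule ccontr)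
      assume "\<not> u \<ge> 0"
      then have r: "r > s" using 1 by simp
      have "(s / r) *\<^sub>R (c - c0) = inverse r *\<^sub>R (s *\<^sub>R (c - c0))"
        by (simp add: divide_inverse mult.commute)
      also have "\<dots> = d - c0" using 1 r by simp
      finally have "d = (s / r) *\<^sub>R c + (1 - s / r) *\<^sub>R c0" by (simp add: algebra_simps)
      moreover have "(s / r) *\<^sub>R c + (1 - s / r) *\<^sub>R c0 \<in> cor C"
        using r 1 by (intro cor_convex_combination[OF C _ c0]) auto
      ultimately show False using 1 disj by auto
    qed
  qed
  then obtain f where f: "linear f" "f \<le> (\<lambda>x. Inf (W x))"
    using sublinear_dominates_linear by blast
  have fW: "f x \<le> s" if "s \<in> W x" for x s
    using f W that by (meson le_funD order_trans)
  have "f x \<le> f c0 + 1" if "x \<in> C" for x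
  proof -
    have "f (x - c0) \<le> 1" using that d0 by (intro fW WI[of 1 0 x d0]) auto
    then show ?thesis using f by (simp add: linear_diff)
  qed
  moreover have "f d \<ge> f c0 + 1" if "d \<in> D" for d
  proof -
    have "f (c0 - d) \<le> - 1" using that c0C by (intro fW WI[of 0 1 c0 d]) auto
    then show ?thesis using f by (simp add: linear_diff)
  qed
  ultimately show ?thesis using f by (intro exI[of _ f] exI[of _ "f c0 + 1"]) auto
qed

section \<open>Cones, their bases and their interiors\<close>

lemma nontrivial_cone_scale:
  "nontrivial_cone K \<Longrightarrow> t \<ge> 0 \<Longrightarrow> x \<in> K \<Longrightarrow> t *\<^sub>R x \<in> K"
  by (auto simp: nontrivial_cone_def cone0_iff_cone cone_def)

lemma normlike_base_cases:
  assumes "seminorm \<psi>" "nontrivial_cone K" "has_normlike_base \<psi> K" "x \<in> K"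
  obtains "x = 0" | t b where "t > 0" "b \<in> normlike_base \<psi> K" "x = t *\<^sub>R b"
proof (cases "x = 0")
  case False
  define b where "b = inverse (\<psi> x) *\<^sub>R x"
  have pos: "\<psi> x > 0" using assms False by (simp add: has_normlike_base_def)
  have "\<psi> b = 1"
    using assms(1) pos sublinear_scale[of \<psi> "inverse (\<psi> x)" x] by (simp add: b_def seminorm_def)
  moreover have "b \<in> K"
    using nontrivial_cone_scale[OF assms(2) _ assms(4)] pos by (simp add: b_def)
  ultimately show ?thesis
    using that(2)[of "\<psi> x" b] pos by (simp add: normlike_base_def b_def)
qed (use that in simp)

lemma cor_uminus: "x \<in> cor C \<Longrightarrow> - x \<in> cor (uminus ` C)"
proof -
  assume x: "x \<in> cor C"
  have "\<exists>e>0. \<forall>t \<in> {0..e}. - x + t *\<^sub>R v \<in> uminus ` C" for v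
  proof -
    obtain e where "e > 0" "\<forall>t \<in> {0..e}. x + t *\<^sub>R (- v) \<in> C"
      using x unfolding cor_def by blast
    then show ?thesis by (intro exI[of _ e]) (force simp: image_iff intro!: bexI)
  qed
  then show ?thesis using x by (auto simp: cor_def)
qed

text \<open>Around an interior point every vector is a positive multiple of a difference of elements
  of \<open>K\<close>, so these differences affinely span the whole space.\<close>

lemma icor_eq_cor:
  assumes "solid K"
  shows "icor K = cor K"
proof -
  obtain x where x: "x \<in> cor K" using assms by (auto simp: solid_def)
  define S where "S = {y - z | y z. y \<in> K \<and> z \<in> K}"
  have xK: "x \<in> K" using x cor_subset by blast
  have "v \<in> affine hull S" for v
  proof -
    obtain t where t: "t > 0" "x + t *\<^sub>R v \<in> K" using cor_D[OF x] by blast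
    have "(x + t *\<^sub>R v) - x \<in> S" "x - x \<in> S" unfolding S_def using t xK by blast+
    then have "0 \<in> affine hull S" "t *\<^sub>R v \<in> affine hull S"
      by (auto intro: hull_inc)
    \<comment> \<open>Rescaling is an affine combination with 0, which is itself such a
      difference.\<close>
    then have "(1 - inverse t) *\<^sub>R 0 + inverse t *\<^sub>R (t *\<^sub>R v) \<in> affine hull S"
      by (intro mem_affine) auto
    then show ?thesis using t by simp
  qed
  then have "affine hull S = UNIV" by blast
  then show ?thesis by (simp add: icor_def cor_def S_def)
qed

text \<open>Move from \<open>k\<close> away from \<open>b\<close> without leaving \<open>C\<close>.
  Then \<open>(1 + t) *\<^sub>R k\<close> is the point reached plus \<open>t *\<^sub>R b\<close>,
  and sublinearity carries the strict sign from \<open>b\<close> to \<open>k\<close>.\<close>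

lemma sublinear_neg_on_cor:
  assumes f: "sublinear f" and le: "\<And>k. k \<in> C \<Longrightarrow> f k \<le> 0" and b: "f b < 0" and k: "k \<in> cor C"
  shows "f k < 0"
proof -
  obtain t where t: "t > 0" "k + t *\<^sub>R (k - b) \<in> C" using cor_D[OF k] by blast
  have "(1 + t) * f k = f ((1 + t) *\<^sub>R k)"
    using t by (simp add: sublinear_scale[OF f])
  also have "\<dots> = f ((k + t *\<^sub>R (k - b)) + t *\<^sub>R b)" by (simp add: algebra_simps)
  also have "\<dots> \<le> f (k + t *\<^sub>R (k - b)) + t * f b"
    using sublinear_add[OF f] sublinear_scale[OF f, of t b] t by (metis less_imp_le)
  also have "\<dots> < 0" using le[OF t(2)] t b by (simp add: add_nonpos_neg mult_pos_neg)
  finally show ?thesis using t by (simp add: mult_less_0_iff)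
qed

lemma sublinear_linear_plus:
  assumes "linear f" "sublinear p" "\<alpha> \<ge> (0::real)"
  shows "sublinear (\<lambda>x. f x + \<alpha> * p x)"
proof -
  have "\<alpha> * p (x + y) \<le> \<alpha> * p x + \<alpha> * p y" for x y
    using mult_left_mono[OF sublinear_add[OF assms(2), of x y] assms(3)]
    by (simp add: distrib_left)
  then show ?thesis
    using assms unfolding sublinear_def
    by (auto simp: linear_add linear_scale algebra_simps)
qed

theorem theorem5p3:
  fixes \<psi> :: "'a::real_vector \<Rightarrow> real" and K A :: "'a set"
  assumes "(UNIV :: 'a set) \<noteq> {0}"
    and "seminorm \<psi>"
    and "nontrivial_cone K" and "nontrivial_cone A"
    and "has_normlike_base \<psi> K" and "has_normlike_base \<psi> A"
    and "solid K"
    and "solid (S_neg \<psi> K)"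
    and "S_zero \<psi> A \<inter> cor (S_neg \<psi> K) = {}"
  shows "(\<exists>(x', \<alpha>) \<in> aug_dual_icor \<psi> K.
            (\<forall>a \<in> A. \<forall>k \<in> uminus ` K.
               x' a + \<alpha> * \<psi> a \<ge> 0 \<and> 0 \<ge> x' k + \<alpha> * \<psi> k) \<and>
            (\<forall>a \<in> A. \<forall>k \<in> cor (uminus ` K).
               x' a + \<alpha> * \<psi> a \<ge> 0 \<and> 0 > x' k + \<alpha> * \<psi> k))
         \<and> A \<inter> cor (uminus ` K) = {}
         \<and> 0 \<notin> cor (S_neg \<psi> K)"
proof -
  note psi = assms(2) and K = assms(3) and A = assms(4)
  have subpsi: "sublinear \<psi>" using psi by (simp add: seminorm_def)
  obtain c0 where c0: "c0 \<in> cor (S_neg \<psi> K)" using assms(8) by (auto simp: solid_def)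
  have zero: "0 \<in> S_zero \<psi> A" by (simp add: S_zero_def hull_inc)
  have "convex (S_neg \<psi> K)" "convex (S_zero \<psi> A)" by (simp_all add: S_neg_def S_zero_def)
  with zero obtain f :: "'a \<Rightarrow> real" and \<gamma>
    where f: "linear f" "\<And>d. d \<in> S_zero \<psi> A \<Longrightarrow> f d \<ge> \<gamma>"
    "\<And>x. x \<in> S_neg \<psi> K \<Longrightarrow> f x \<le> \<gamma>" "f c0 < \<gamma>"
    using separation_cor[OF _ _ _ c0 assms(9)] by blast
  \<comment> \<open>As \<psi> equals 1 on \<open>B\<^sub>A\<close> and on \<open>-B\<^sub>K\<close>,
    there \<open>g\<close> is \<open>f\<close> minus the level \<open>\<gamma>\<close>: separation
    at \<open>\<gamma>\<close> becomes a sign condition on \<open>g\<close>.\<close>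
  define \<alpha> where "\<alpha> = - \<gamma>"
  define g where "g x = f x + \<alpha> * \<psi> x" for x
  have \<alpha>: "\<alpha> \<ge> 0" using f(2)[OF zero] f(1) by (simp add: \<alpha>_def linear_0)
  have g: "sublinear g" unfolding g_def
    using sublinear_linear_plus[OF f(1) subpsi \<alpha>] .
  have gA: "g a \<ge> 0" if "a \<in> A" for a
    using psi A assms(6) that
  proof (cases rule: normlike_base_cases)
    case 1
    then show ?thesis using sublinear_zero[OF g] by simp
  next
    case (2 t b)
    then have "b \<in> S_zero \<psi> A" by (simp add: S_zero_def hull_inc)
    then have "g b \<ge> 0" using f(2)[of b] 2 by (simp add: g_def \<alpha>_def normlike_base_def)
    then show ?thesis using 2 sublinear_scale[OF g] by simp
  qed
  have gB: "g (- b) = f (- b) - \<gamma>" if "b \<in> normlike_base \<psi> K" for b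
    using that psi by (simp add: g_def \<alpha>_def normlike_base_def seminorm_def)
  have gK: "g k \<le> 0" if "k \<in> uminus ` K" for k
  proof -
    have "- k \<in> K" using that by auto
    with psi K assms(5) show ?thesis
    proof (cases rule: normlike_base_cases)
      case 1
      then show ?thesis using sublinear_zero[OF g] by simp
    next
      case (2 t b)
      then have k: "k = t *\<^sub>R (- b)" by (metis minus_minus scaleR_minus_right)
      have "- b \<in> S_neg \<psi> K" using 2 by (simp add: S_neg_def hull_inc)
      then have "g (- b) \<le> 0" using f(3) gB 2 by simp
      then show ?thesis
        using 2 sublinear_scale[OF g, of t "- b"] by (simp add: k mult_le_0_iff)
    qed
  qed
  obtain b where b: "g b < 0"
  proof -
    \<comment> \<open>Otherwise the convex half-space \<open>f x \<ge> \<gamma>\<close> would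
      contain the hull \<open>S_neg \<psi> K\<close> and with it \<open>c0\<close>.\<close>
    have "\<not> uminus ` normlike_base \<psi> K \<subseteq> {x. f x \<ge> \<gamma>}"
    proof
      assume "uminus ` normlike_base \<psi> K \<subseteq> {x. f x \<ge> \<gamma>}"
      moreover have "convex {x. f x \<ge> \<gamma>}"
        using convex_linear_vimage[OF f(1), of "{\<gamma>..}"] by (simp add: vimage_def)
      ultimately have "S_neg \<psi> K \<subseteq> {x. f x \<ge> \<gamma>}" by (simp add: S_neg_def hull_minimal)
      then show False using f(4) c0 cor_subset[of "S_neg \<psi> K"] by auto
    qed
    then obtain b where "b \<in> normlike_base \<psi> K" "f (- b) < \<gamma>"
      by (auto simp: image_subset_iff not_le)
    then show ?thesis using that[of "- b"] gB by simp
  qed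
  have gcor: "g k < 0" if "k \<in> cor (uminus ` K)" for k
    using sublinear_neg_on_cor[OF g gK b that] .
  \<comment> \<open>Symmetry of \<psi> turns the sign of \<open>g\<close> at \<open>- y\<close> into
    the inequality defining the augmented dual cone.\<close>
  have dual: "f y - \<alpha> * \<psi> y \<ge> 0" if "y \<in> K" for y
    using gK[of "- y"] that f(1) psi by (simp add: g_def linear_neg seminorm_def)
  have strict: "f y - \<alpha> * \<psi> y > 0" if "y \<in> cor K" for y
    using gcor[OF cor_uminus[OF that]] f(1) psi by (simp add: g_def linear_neg seminorm_def)
  have nonneg: "\<alpha> * \<psi> y \<ge> 0" for y using \<alpha> seminorm_nonneg[OF psi] by simp
  have fK: "f y \<ge> 0" if "y \<in> K" for y using dual[OF that] nonneg[of y] by simp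
  \<comment> \<open>A point of \<open>K\<close> with \<open>f y > 0\<close> keeps \<open>- f\<close>
    out of the dual cone, so \<open>f\<close> is not in its lineality space.\<close>
  obtain y where y: "y \<in> cor K" using assms(7) by (auto simp: solid_def)
  have "f y > 0" using strict[OF y] nonneg[of y] by simp
  moreover have "y \<in> K" using y cor_subset by blast
  ultimately have "f \<notin> lineality (dual_cone K)"
    by (force simp: lineality_def dual_cone_def)
  then have mem: "(f, \<alpha>) \<in> aug_dual_icor \<psi> K"
    using f(1) fK \<alpha> strict icor_eq_cor[OF assms(7)]
    by (simp add: aug_dual_icor_def dual_cone_def algebraic_dual_def)
  \<comment> \<open>A common point would make \<open>g\<close> both nonnegative and
    negative.\<close>
  have "A \<inter> cor (uminus ` K) = {}" using gA gcor by force
  moreover have "0 \<notin> cor (S_neg \<psi> K)" using zero assms(9) by blast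
  ultimately show ?thesis
    using gA gK gcor unfolding g_def by (intro conjI bexI[OF _ mem]) auto
qed

end
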